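(* Let $f$ have a zero $\alpha$ of known multiplicity $m\ge 1$, and consider the three-point iterative family $$ \begin{cases} y_k=x_k-m\,\dfrac{f(x_k)}{f'(x_k)},\\[6pt] z_k=y_k-m\,u_kH(u_k)\,\dfrac{f(x_k)}{f'(x_k)},\\[6pt] x_{k+1}=z_k-m\,u_kv_k(1+2u_kv_k)\,P(u_k)\,G(v_k)\,\dfrac{f(x_k)}{f'(x_k)}, \end{cases} \qquad u_k=\Bigl(\frac{f(y_k)}{f(x_k)}\Bigr)^{1/m},\quad v_k=\Bigl(\frac{f(z_k)}{f(y_k)}\Bigr)^{1/m}\qquad(k=0,1,\ldots). $$ If the weight functions $H,P,G$ satisfy $$ H(0)=1,\quad H'(0)=2,\quad H''(0)=m+9, $$ $$ P(0)=1,\quad P'(0)=2,\quad P''(0)=m+11,\quad P'''(0)=30+6m+H'''(0), $$ $$ G(0)=1,\quad G'(0)=1, $$ then the method is of order eight, i.e. $x_{k+1}-\alpha=O\bigl((x_k-\alpha)^8\bigr)$ for $x_k$ sufficiently close to $\alpha$.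
   Context: $f$ is a real function of a real variable, infinitely differentiable near $\alpha$ (or a complex function holomorphic near $\alpha$), with $f(\alpha)=\dots=f^{(m-1)}(\alpha)=0$ and $f^{(m)}(\alpha)\neq 0$. The functions $H,P,G$ of one variable are smooth near $0$. The initial approximation $x_0$ is assumed sufficiently close to $\alpha$. Meaning of the $m$-th roots: write $f(x)=\frac{f^{(m)}(\alpha)}{m!}(x-\alpha)^m h(x)$ with $h(\alpha)=1$, and let $h^{1/m}$ be the smooth $m$-th root near $\alpha$ with $h(\alpha)^{1/m}=1$. Then $$ \Bigl(\frac{f(s)}{f(t)}\Bigr)^{1/m}:=\frac{(s-\alpha)\,h(s)^{1/m}}{(t-\alpha)\,h(t)^{1/m}} , $$ that is, the root of the ratio equals $F(s)/F(t)$, where $F=f^{1/m}$ (up to a constant factor) is the function for which $\alpha$ is a simple zero. "Order eight" means that there are a neighborhood of $\alpha$ and a constant $C$ such that $|x_{k+1}-\alpha|\le C|x_k-\alpha|^8$ for every $x_k$ in this neighborhood for which the step is defined (i.e. $f(x_k)\ne0$, $f(y_k)\neq 0$; otherwise a zero has been found exactly and the iteration stops). *)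

theory Defs
  imports "HOL-Analysis.Analysis"
begin

text \<open>
  The definitions are stated once for a field that is meant to be either
  \<^typ>\<open>real\<close> or \<^typ>\<open>complex\<close>. The class \<^class>\<open>ln\<close> provides \<^const>\<open>powr\<close>, which on the
  complex numbers is the principal power.
\<close>

definition smooth_near :: "('a::real_normed_field \<Rightarrow> 'a) \<Rightarrow> 'a \<Rightarrow> bool" where
  "smooth_near f a \<longleftrightarrow>
     (\<exists>S. open S \<and> a \<in> S \<and> (\<forall>n. \<forall>x\<in>S. ((deriv ^^ n) f) field_differentiable (at x)))"

definition zero_of_multiplicity :: "('a::real_normed_field \<Rightarrow> 'a) \<Rightarrow> 'a \<Rightarrow> nat \<Rightarrow> bool" where
  "zero_of_multiplicity f \<alpha> m \<longleftrightarrow>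
     (\<forall>i<m. (deriv ^^ i) f \<alpha> = 0) \<and> (deriv ^^ m) f \<alpha> \<noteq> 0"

definition cofactor :: "('a::real_normed_field \<Rightarrow> 'a) \<Rightarrow> 'a \<Rightarrow> nat \<Rightarrow> 'a \<Rightarrow> 'a" where
  "cofactor f \<alpha> m x =
     (if x = \<alpha> then 1 else f x / ((deriv ^^ m) f \<alpha> / fact m * (x - \<alpha>) ^ m))"

text \<open>
  Near \<open>\<alpha>\<close> the cofactor \<open>h\<close> is close to \<open>1\<close>, so that \<open>h powr (1 / m)\<close> is the branch of the
  \<open>m\<close>-th root of \<open>h\<close> that is smooth near \<open>\<alpha>\<close> and equals \<open>1\<close> there; the lemmas
  \<open>continuous_root_real\<close> and \<open>continuous_root_complex\<close> below show that no other function
  can be meant. Away from \<open>\<alpha>\<close> the values are irrelevant.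
\<close>

definition cofactor_root :: "('a::{real_normed_field,ln} \<Rightarrow> 'a) \<Rightarrow> 'a \<Rightarrow> nat \<Rightarrow> 'a \<Rightarrow> 'a" where
  "cofactor_root f \<alpha> m x = cofactor f \<alpha> m x powr (1 / of_nat m)"

definition ratio_root :: "('a::{real_normed_field,ln} \<Rightarrow> 'a) \<Rightarrow> 'a \<Rightarrow> nat \<Rightarrow> 'a \<Rightarrow> 'a \<Rightarrow> 'a" where
  "ratio_root f \<alpha> m s t =
     ((s - \<alpha>) * cofactor_root f \<alpha> m s) / ((t - \<alpha>) * cofactor_root f \<alpha> m t)"

definition y_step :: "('a::real_normed_field \<Rightarrow> 'a) \<Rightarrow> nat \<Rightarrow> 'a \<Rightarrow> 'a" where
  "y_step f m x = x - of_nat m * (f x / deriv f x)"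

definition u_ratio :: "('a::{real_normed_field,ln} \<Rightarrow> 'a) \<Rightarrow> 'a \<Rightarrow> nat \<Rightarrow> 'a \<Rightarrow> 'a" where
  "u_ratio f \<alpha> m x = ratio_root f \<alpha> m (y_step f m x) x"

definition z_step ::
  "('a::{real_normed_field,ln} \<Rightarrow> 'a) \<Rightarrow> 'a \<Rightarrow> nat \<Rightarrow> ('a \<Rightarrow> 'a) \<Rightarrow> 'a \<Rightarrow> 'a" where
  "z_step f \<alpha> m H x =
     (let u = u_ratio f \<alpha> m x
      in y_step f m x - of_nat m * u * H u * (f x / deriv f x))"

definition v_ratio ::
  "('a::{real_normed_field,ln} \<Rightarrow> 'a) \<Rightarrow> 'a \<Rightarrow> nat \<Rightarrow> ('a \<Rightarrow> 'a) \<Rightarrow> 'a \<Rightarrow> 'a" where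
  "v_ratio f \<alpha> m H x = ratio_root f \<alpha> m (z_step f \<alpha> m H x) (y_step f m x)"

definition next_iterate ::
  "('a::{real_normed_field,ln} \<Rightarrow> 'a) \<Rightarrow> 'a \<Rightarrow> nat \<Rightarrow>
     ('a \<Rightarrow> 'a) \<Rightarrow> ('a \<Rightarrow> 'a) \<Rightarrow> ('a \<Rightarrow> 'a) \<Rightarrow> 'a \<Rightarrow> 'a" where
  "next_iterate f \<alpha> m H P G x =
     (let u = u_ratio f \<alpha> m x; v = v_ratio f \<alpha> m H x
      in z_step f \<alpha> m H x
           - of_nat m * u * v * (1 + 2 * u * v) * P u * G v * (f x / deriv f x))"

definition step_defined :: "('a::real_normed_field \<Rightarrow> 'a) \<Rightarrow> nat \<Rightarrow> 'a \<Rightarrow> bool" where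
  "step_defined f m x \<longleftrightarrow> f x \<noteq> 0 \<and> f (y_step f m x) \<noteq> 0"

definition has_order ::
  "nat \<Rightarrow> ('a::{real_normed_field,ln} \<Rightarrow> 'a) \<Rightarrow> 'a \<Rightarrow> nat \<Rightarrow>
     ('a \<Rightarrow> 'a) \<Rightarrow> ('a \<Rightarrow> 'a) \<Rightarrow> ('a \<Rightarrow> 'a) \<Rightarrow> bool" where
  "has_order p f \<alpha> m H P G \<longleftrightarrow>
     (\<exists>U C. open U \<and> \<alpha> \<in> U \<and>
        (\<forall>x\<in>U. step_defined f m x \<longrightarrow>
           norm (next_iterate f \<alpha> m H P G x - \<alpha>) \<le> C * norm (x - \<alpha>) ^ p))"

definition weight_conditions ::
  "nat \<Rightarrow> ('a::real_normed_field \<Rightarrow> 'a) \<Rightarrow> ('a \<Rightarrow> 'a) \<Rightarrow> ('a \<Rightarrow> 'a) \<Rightarrow> bool" where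
  "weight_conditions m H P G \<longleftrightarrow>
     H 0 = 1 \<and> deriv H 0 = 2 \<and> (deriv ^^ 2) H 0 = of_nat m + 9 \<and>
     P 0 = 1 \<and> deriv P 0 = 2 \<and> (deriv ^^ 2) P 0 = of_nat m + 11 \<and>
     (deriv ^^ 3) P 0 = 30 + 6 * of_nat m + (deriv ^^ 3) H 0 \<and>
     G 0 = 1 \<and> deriv G 0 = 1"

lemma continuous_root_real:
  fixes h r :: "real \<Rightarrow> real"
  assumes m: "m \<ge> 1" and r: "isCont r \<alpha>" "r \<alpha> = 1"
    and root: "\<forall>\<^sub>F x in nhds \<alpha>. r x ^ m = h x"
  shows "\<forall>\<^sub>F x in nhds \<alpha>. r x = h x powr (1 / of_nat m)"
proof -
  have "(r \<longlongrightarrow> 1) (nhds \<alpha>)"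
    using r by (metis isCont_def tendsto_at_iff_tendsto_nhds)
  then have "\<forall>\<^sub>F x in nhds \<alpha>. r x > 0"
    by (rule order_tendstoD) simp
  with root show ?thesis
  proof eventually_elim
    case (elim x)
    have "h x powr (1 / of_nat m) = (r x powr real m) powr (1 / real m)"
      using elim by (simp add: powr_realpow)
    also have "\<dots> = r x" using elim m by (simp add: powr_powr)
    finally show ?case by simp
  qed
qed

lemma continuous_root_complex:
  fixes h r :: "complex \<Rightarrow> complex"
  assumes m: "m \<ge> 1" and r: "isCont r \<alpha>" "r \<alpha> = 1"
    and root: "\<forall>\<^sub>F x in nhds \<alpha>. r x ^ m = h x"
  shows "\<forall>\<^sub>F x in nhds \<alpha>. r x = h x powr (1 / of_nat m)"
proof -
  have lim: "(r \<longlongrightarrow> 1) (nhds \<alpha>)"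
    using r by (metis isCont_def tendsto_at_iff_tendsto_nhds)
  then have "\<forall>\<^sub>F x in nhds \<alpha>. r x \<noteq> 0"
    by (rule tendsto_imp_eventually_ne) simp
  moreover have "((\<lambda>x. Im (Ln (r x))) \<longlongrightarrow> Im (Ln 1)) (nhds \<alpha>)"
    by (intro tendsto_intros lim) auto
  then have "((\<lambda>x. \<bar>Im (Ln (r x))\<bar>) \<longlongrightarrow> 0) (nhds \<alpha>)"
    by (auto dest: tendsto_rabs)
  then have "\<forall>\<^sub>F x in nhds \<alpha>. \<bar>Im (Ln (r x))\<bar> < pi / real m"
    by (rule order_tendstoD) (use m in auto)
  ultimately show ?thesis using root
  proof eventually_elim
    case (elim x)
    have b: "\<bar>real m * Im (Ln (r x))\<bar> < pi"
      using elim(2) m by (simp add: abs_mult field_simps)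
    have "h x = exp (of_nat m * Ln (r x))"
      using elim by (simp add: exp_of_nat_mult)
    then have "h x \<noteq> 0" and "Ln (h x) = of_nat m * Ln (r x)"
      using b by (auto intro!: Ln_exp)
    then show ?case
      using elim(1) m by (simp add: powr_def)
  qed
qed

end

theory Submission
  imports Defs "HOL-Library.Landau_Symbols" "HOL-Complex_Analysis.Cauchy_Integral_Formula"
begin

text \<open>
  Write \<open>e = x - \<alpha>\<close>, let \<open>r e\<close> be the \<open>m\<close>-th root of the cofactor at \<open>\<alpha> + e\<close> and
  \<open>F e = e * r e\<close>, so that \<open>m f / f' = F / F' = e W\<close> and the method is the one for the simple
  zero of \<open>F\<close>. The errors of the first two steps are \<open>y = e (1 - W)\<close> and
  \<open>z = y (1 - r y H u / F')\<close>, where the last factor is \<open>O(e\<^sup>2)\<close>, hence \<open>z = O(e\<^sup>4)\<close>.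
  As \<open>u v F e = F z\<close>, the final error is \<open>z (1 - r z (1 + 2 u v) P u G v / F')\<close>, and \<open>y\<close>
  cancels in \<open>v = (z / y) (r z / r y)\<close>. So order eight only requires that the second factor
  of the final error is \<open>O(e\<^sup>4)\<close>, a computation with expansions up to the cubic term.
\<close>

section \<open>Arithmetic of expansions up to the cubic term\<close>

text \<open>The filter is a parameter because the outer function of a composition is expanded along
  \<open>nhds 0\<close>, while functions with a division by \<open>e\<close> are expanded along
  \<open>at 0\<close>.\<close>

definition cubic_expansion ::
  "'a::real_normed_field filter \<Rightarrow> ('a \<Rightarrow> 'a) \<Rightarrow> 'a \<Rightarrow> 'a \<Rightarrow> 'a \<Rightarrow> 'a \<Rightarrow> bool" where
  "cubic_expansion F g a b c d \<longleftrightarrow> (\<lambda>e. g e - (a + b * e + c * e ^ 2 + d * e ^ 3)) \<in> O[F](\<lambda>e. e ^ 4)"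

lemma tendsto_imp_bigo_1:
  fixes g :: "'a \<Rightarrow> 'b::real_normed_field"
  assumes "(g \<longlongrightarrow> l) F"
  shows "g \<in> O[F](\<lambda>_. 1)"
  by (rule bigoI_tendsto[of _ _ l]) (use assms in auto)

lemma tendsto_ident_le_nhds:
  assumes "F \<le> nhds 0"
  shows "((\<lambda>e::'a::real_normed_field. e) \<longlongrightarrow> 0) F"
  using assms by (simp add: filterlim_def)

lemma cubic_expansion_const: "cubic_expansion F (\<lambda>_. a) a 0 0 0"
  by (simp add: cubic_expansion_def)

lemma cubic_expansion_ident: "cubic_expansion F (\<lambda>e. e) 0 1 0 0"
  by (simp add: cubic_expansion_def)

lemma cubic_expansion_0_iff: "cubic_expansion F f 0 0 0 0 \<longleftrightarrow> f \<in> O[F](\<lambda>e. e ^ 4)"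
  by (simp add: cubic_expansion_def)

lemma cubic_expansion_add:
  assumes "cubic_expansion F f a b c d" "cubic_expansion F g a' b' c' d'"
  shows "cubic_expansion F (\<lambda>e. f e + g e) (a + a') (b + b') (c + c') (d + d')"
  using sum_in_bigo(1)[OF assms[unfolded cubic_expansion_def]]
  by (simp add: cubic_expansion_def algebra_simps)

lemma cubic_expansion_diff:
  assumes "cubic_expansion F f a b c d" "cubic_expansion F g a' b' c' d'"
  shows "cubic_expansion F (\<lambda>e. f e - g e) (a - a') (b - b') (c - c') (d - d')"
  using sum_in_bigo(2)[OF assms[unfolded cubic_expansion_def]]
  by (simp add: cubic_expansion_def algebra_simps)

lemma cubic_expansion_tendsto:
  assumes "cubic_expansion F g a b c d" "F \<le> nhds 0"
  shows "(g \<longlongrightarrow> a) F"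
proof -
  note id = tendsto_ident_le_nhds[OF assms(2)]
  have "((\<lambda>e. e ^ 4) \<longlongrightarrow> 0 ^ 4) F"
    by (intro tendsto_intros id)
  then have "(\<lambda>e. e ^ 4) \<in> o[F](\<lambda>_. 1)"
    by (intro smalloI_tendsto) auto
  then have "(\<lambda>e. g e - (a + b * e + c * e ^ 2 + d * e ^ 3)) \<in> o[F](\<lambda>_. 1)"
    using assms(1) unfolding cubic_expansion_def by (rule landau_o.big_small_trans[rotated])
  then have "((\<lambda>e. g e - (a + b * e + c * e ^ 2 + d * e ^ 3)) \<longlongrightarrow> 0) F"
    using smalloD_tendsto by fastforce
  moreover have "((\<lambda>e. a + b * e + c * e ^ 2 + d * e ^ 3) \<longlongrightarrow> a + b * 0 + c * 0 ^ 2 + d * 0 ^ 3) F"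
    by (intro tendsto_intros id)
  ultimately show ?thesis
    using tendsto_add by fastforce
qed

lemma cubic_expansion_mult:
  fixes f g :: "'a::real_normed_field \<Rightarrow> 'a"
  assumes F: "F \<le> nhds 0"
    and f: "cubic_expansion F f a b c d" and g: "cubic_expansion F g a' b' c' d'"
  shows "cubic_expansion F (\<lambda>e. f e * g e) (a * a') (a * b' + b * a') (a * c' + b * b' + c * a')
           (a * d' + b * c' + c * b' + d * a')"
proof -
  note id = tendsto_ident_le_nhds[OF F]
  define p where "p e = a + b * e + c * e ^ 2 + d * e ^ 3" for e
  define p' where "p' e = a' + b' * e + c' * e ^ 2 + d' * e ^ 3" for e
  \<comment> \<open>The product of the cubic polynomials exceeds its truncation by
    \<open>e ^ 4 * s e\<close>: the coefficients of \<open>s\<close> are those of degree 4 to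
    6.\<close>
  define s where "s e = b * d' + c * c' + d * b' + (c * d' + d * c') * e + d * d' * e ^ 2" for e
  have "(\<lambda>e. (f e - p e) * g e) \<in> O[F](\<lambda>e. e ^ 4 * 1)"
    using f[unfolded cubic_expansion_def] tendsto_imp_bigo_1[OF cubic_expansion_tendsto[OF g F]]
    unfolding p_def by (rule landau_o.big.mult)
  moreover have "(p \<longlongrightarrow> a + b * 0 + c * 0 ^ 2 + d * 0 ^ 3) F"
    unfolding p_def by (intro tendsto_intros id)
  then have "(\<lambda>e. p e * (g e - p' e)) \<in> O[F](\<lambda>e. 1 * e ^ 4)"
    using g[unfolded cubic_expansion_def] unfolding p'_def
    by (intro landau_o.big.mult tendsto_imp_bigo_1)
  moreover have "(s \<longlongrightarrow> b * d' + c * c' + d * b' + (c * d' + d * c') * 0 + d * d' * 0 ^ 2) F"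
    unfolding s_def by (intro tendsto_intros id)
  then have "(\<lambda>e. e ^ 4 * s e) \<in> O[F](\<lambda>e. e ^ 4 * 1)"
    by (intro landau_o.big.mult tendsto_imp_bigo_1) auto
  ultimately have
    "(\<lambda>e. (f e - p e) * g e + p e * (g e - p' e) + e ^ 4 * s e) \<in> O[F](\<lambda>e. e ^ 4)"
    by (intro sum_in_bigo) simp_all
  moreover have "(f e - p e) * g e + p e * (g e - p' e) + e ^ 4 * s e =
      f e * g e - (a * a' + (a * b' + b * a') * e + (a * c' + b * b' + c * a') * e ^ 2
        + (a * d' + b * c' + c * b' + d * a') * e ^ 3)" for e
    unfolding p_def p'_def s_def by algebra
  ultimately show ?thesis
    by (simp add: cubic_expansion_def)
qed

text \<open>With \<open>p\<close> the polynomial of the proposed coefficients,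
  \<open>f - g * p\<close> is O(e^4), and dividing by \<open>g\<close> keeps this order because
  \<open>1 / g\<close> is bounded. The coefficients are characterised by the Cauchy product
  equations, so that each use only has to verify polynomial identities.\<close>

lemma cubic_expansion_divide:
  fixes f g :: "'a::real_normed_field \<Rightarrow> 'a"
  assumes F: "F \<le> nhds 0"
    and f: "cubic_expansion F f a b c d" and g: "cubic_expansion F g a' b' c' d'" and nz: "a' \<noteq> 0"
    and q: "a = a' * q0" "b = a' * q1 + b' * q0" "c = a' * q2 + b' * q1 + c' * q0"
      "d = a' * q3 + b' * q2 + c' * q1 + d' * q0"
  shows "cubic_expansion F (\<lambda>e. f e / g e) q0 q1 q2 q3"
proof -
  define p where "p e = q0 + q1 * e + q2 * e ^ 2 + q3 * e ^ 3" for e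
  have g0: "(g \<longlongrightarrow> a') F" by (rule cubic_expansion_tendsto[OF g F])
  have "cubic_expansion F p q0 q1 q2 q3" by (simp add: cubic_expansion_def p_def)
  from cubic_expansion_diff[OF f cubic_expansion_mult[OF F g this]] q
  have "cubic_expansion F (\<lambda>e. f e - g e * p e) 0 0 0 0" by simp
  then have "(\<lambda>e. f e - g e * p e) \<in> O[F](\<lambda>e. e ^ 4)" by (simp add: cubic_expansion_def)
  moreover have "(\<lambda>e. inverse (g e)) \<in> O[F](\<lambda>_. 1)"
    by (rule tendsto_imp_bigo_1[OF tendsto_inverse[OF g0 nz]])
  ultimately have "(\<lambda>e. (f e - g e * p e) * inverse (g e)) \<in> O[F](\<lambda>e. e ^ 4 * 1)"
    by (rule landau_o.big.mult)
  moreover have "\<forall>\<^sub>F e in F. (f e - g e * p e) * inverse (g e) = f e / g e - p e"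
    using tendsto_imp_eventually_ne[OF g0 nz] by eventually_elim (simp add: field_simps)
  ultimately have "(\<lambda>e. f e / g e - p e) \<in> O[F](\<lambda>e. e ^ 4)"
    using landau_o.big.in_cong by fastforce
  then show ?thesis by (simp add: cubic_expansion_def p_def)
qed

text \<open>The inner function is O(e), so the remainder O(t^4) of \<open>f\<close> becomes O(e^4)
  after substitution. The expansion of \<open>f\<close> must hold along \<open>nhds 0\<close>, since
  \<open>g e\<close> may be 0 for \<open>e\<close> arbitrarily close to 0.\<close>

lemma cubic_expansion_compose:
  fixes f g :: "'a::real_normed_field \<Rightarrow> 'a"
  assumes F: "F \<le> nhds 0"
    and f: "cubic_expansion (nhds 0) f a b c d" and g: "cubic_expansion F g 0 b' c' d'"
  shows "cubic_expansion F (\<lambda>e. f (g e)) a (b * b') (b * c' + c * b' ^ 2)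
           (b * d' + 2 * c * b' * c' + d * b' ^ 3)"
proof -
  have g0: "(g \<longlongrightarrow> 0) F" by (rule cubic_expansion_tendsto[OF g F])
  define p where "p t = a + b * t + c * t ^ 2 + d * t ^ 3" for t
  have fg: "(\<lambda>e. f (g e) - p (g e)) \<in> O[F](\<lambda>e. g e ^ 4)"
    using landau_o.big.compose[OF f[unfolded cubic_expansion_def] g0] unfolding p_def .
  note mult = cubic_expansion_mult[OF F]
  note g2 = mult[OF g g] note g3 = mult[OF g g2] note g4 = mult[OF g g3]
  have "(\<lambda>e. g e ^ 4) \<in> O[F](\<lambda>e. e ^ 4)"
    using g4 by (simp add: cubic_expansion_def numeral_eq_Suc)
  with fg have "cubic_expansion F (\<lambda>e. f (g e) - p (g e)) 0 0 0 0"
    by (auto simp: cubic_expansion_def intro: landau_o.big_trans)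
  moreover have "cubic_expansion F (\<lambda>e. p (g e)) a (b * b') (b * c' + c * b' ^ 2)
           (b * d' + 2 * c * b' * c' + d * b' ^ 3)"
    using cubic_expansion_add[OF cubic_expansion_add[OF cubic_expansion_add[OF cubic_expansion_const[of F a] mult[OF cubic_expansion_const[of F b] g]]
       mult[OF cubic_expansion_const[of F c] g2]] mult[OF cubic_expansion_const[of F d] g3]]
    by (simp add: p_def power2_eq_square power3_eq_cube algebra_simps)
  ultimately show ?thesis
    using cubic_expansion_add by fastforce
qed

text \<open>At \<open>e = 0\<close> the remainder is \<open>f 0 - a = 0\<close>, so the bound on the
  punctured neighborhood extends to the centre.\<close>

lemma cubic_expansion_nhds:
  assumes "cubic_expansion (at 0) f a b c d" "f 0 = a"
  shows "cubic_expansion (nhds 0) f a b c d"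
proof -
  obtain C where C: "\<forall>\<^sub>F e in at 0. norm (f e - (a + b * e + c * e ^ 2 + d * e ^ 3)) \<le> C * norm (e ^ 4)"
    using assms(1) unfolding cubic_expansion_def by (elim landau_o.bigE)
  then have "\<forall>\<^sub>F e in nhds 0. norm (f e - (a + b * e + c * e ^ 2 + d * e ^ 3)) \<le> C * norm (e ^ 4)"
    unfolding eventually_at_filter by eventually_elim (use assms(2) in auto)
  then show ?thesis unfolding cubic_expansion_def by (rule bigoI)
qed

lemma cubic_expansion_cong:
  assumes "cubic_expansion (at 0) f a b c d" "\<And>e. e \<noteq> 0 \<Longrightarrow> f e = g e"
  shows "cubic_expansion (at 0) g a b c d"
proof -
  have "\<forall>\<^sub>F e in at 0. f e - (a + b * e + c * e ^ 2 + d * e ^ 3) = g e - (a + b * e + c * e ^ 2 + d * e ^ 3)"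
    using assms(2) by (auto simp: eventually_at_filter)
  from landau_o.big.in_cong[OF this] assms(1) show ?thesis
    by (simp add: cubic_expansion_def)
qed

lemma cubic_expansion_mono:
  assumes "cubic_expansion G f a b c d" "F \<le> G"
  shows "cubic_expansion F f a b c d"
  using assms landau_o.big.filter_mono unfolding cubic_expansion_def by blast

section \<open>Taylor expansion, uniformly for real and complex functions\<close>

text \<open>Induction on \<open>n\<close>: the remainder of \<open>p 0\<close> has the remainder of
  \<open>p 1\<close>, of order one less, as its derivative, and the mean value inequality gains one
  factor \<open>e\<close>. An abstract sequence of successive derivatives allows the shift by one in
  the induction and the use of explicit formulas for them.\<close>

lemma taylor_bigo:
  fixes p :: "nat \<Rightarrow> 'a::real_normed_field \<Rightarrow> 'a"
  assumes S: "open S" "a \<in> S"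
    and p: "\<And>k x. x \<in> S \<Longrightarrow> (p k has_field_derivative p (Suc k) x) (at x)"
  shows "(\<lambda>e. p 0 (a + e) - (\<Sum>k<n. p k a / fact k * e ^ k)) \<in> O[nhds 0](\<lambda>e. e ^ n)"
  using p
proof (induction n arbitrary: p)
  case 0
  have "isCont (p 0) a"
    using 0[OF S(2)] DERIV_isCont by blast
  then have "((\<lambda>e. p 0 (a + e)) \<longlongrightarrow> p 0 a) (at 0)"
    by (simp add: isCont_def LIM_offset_zero_iff)
  then have "((\<lambda>e. p 0 (a + e)) \<longlongrightarrow> p 0 a) (nhds 0)"
    using tendsto_at_iff_tendsto_nhds[of "\<lambda>e. p 0 (a + e)" 0] by simp
  then show ?case by (simp add: tendsto_imp_bigo_1)
next
  case (Suc n)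
  define g where "g e = p 0 (a + e) - (\<Sum>k<Suc n. p k a / fact k * e ^ k)" for e
  define g' where "g' e = p 1 (a + e) - (\<Sum>k<n. p (Suc k) a / fact k * e ^ k)" for e
  have "g' \<in> O[nhds 0](\<lambda>e. e ^ n)"
    using Suc.IH[of "\<lambda>k. p (Suc k)"] Suc.prems by (simp add: g'_def[abs_def])
  then obtain C where C: "C > 0" "\<forall>\<^sub>F e in nhds 0. norm (g' e) \<le> C * norm (e ^ n)"
    by (elim landau_o.bigE)
  obtain \<delta>1 where \<delta>1: "\<delta>1 > 0" "\<And>e. norm e < \<delta>1 \<Longrightarrow> norm (g' e) \<le> C * norm (e ^ n)"
    using C(2) by (auto simp: eventually_nhds_metric)
  obtain \<delta>2 where \<delta>2: "\<delta>2 > 0" "ball a \<delta>2 \<subseteq> S"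
    using S open_contains_ball by blast
  have deriv: "(g has_field_derivative g' e) (at e within cball 0 t)" if "norm e < \<delta>2" for e t
  proof -
    have "a + e \<in> S" using that \<delta>2(2) by (auto simp: dist_norm)
    from Suc.prems[OF this, of 0]
    have d1: "((\<lambda>e. p 0 (a + e)) has_field_derivative p 1 (a + e)) (at e)"
      using DERIV_shift[of "p 0" "p 1 (a + e)" e a] by (simp add: add.commute)
    have d2: "((\<lambda>e. p (Suc k) a / fact (Suc k) * e ^ Suc k) has_field_derivative
        p (Suc k) a / fact k * e ^ k) (at e)" for k
    proof -
      have "p (Suc k) a / fact (Suc k) * (of_nat (Suc k) * e ^ k) = p (Suc k) a / fact k * e ^ k"
        by (simp add: fact_Suc divide_simps del: of_nat_Suc)
      then show ?thesis
        by (auto intro!: derivative_eq_intros simp: mult_ac simp del: of_nat_Suc power_Suc fact_Suc)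
    qed
    have "(g has_field_derivative p 1 (a + e) - (0 + (\<Sum>k<n. p (Suc k) a / fact k * e ^ k))) (at e)"
      unfolding g_def[abs_def] sum.lessThan_Suc_shift power_0 fact_0
      by (intro DERIV_diff DERIV_add DERIV_const DERIV_sum d1 d2)
    then have "(g has_field_derivative g' e) (at e)"
      by (simp add: g'_def)
    then show ?thesis by (rule has_field_derivative_at_within)
  qed
  have g0: "g 0 = 0"
    unfolding g_def sum.lessThan_Suc_shift by simp
  have "norm (g e) \<le> C * norm (e ^ Suc n)" if e: "norm e < min \<delta>1 \<delta>2" for e
  proof -
    \<comment> \<open>The ball \<open>cball 0 (norm e)\<close> is convex and contains 0 and
      \<open>e\<close>; on it \<open>g'\<close> is bounded by
      \<open>C * norm (e ^ n)\<close>.\<close>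
    have "norm (g e - g 0) \<le> C * norm (e ^ n) * norm (e - 0)"
    proof (rule field_differentiable_bound[of "cball 0 (norm e)"])
      fix z :: 'a assume z: "z \<in> cball 0 (norm e)"
      then show "(g has_field_derivative g' z) (at z within cball 0 (norm e))"
        using e by (intro deriv) auto
      have "norm (g' z) \<le> C * norm (z ^ n)" using z e by (intro \<delta>1(2)) auto
      also have "\<dots> \<le> C * norm (e ^ n)"
        using z C(1) by (auto simp: norm_power intro!: power_mono)
      finally show "norm (g' z) \<le> C * norm (e ^ n)" .
    qed auto
    then show ?thesis by (simp add: g0 norm_mult mult_ac)
  qed
  then have "\<forall>\<^sub>F e in nhds 0. norm (g e) \<le> C * norm (e ^ Suc n)"
    unfolding eventually_nhds_metric using \<delta>1(1) \<delta>2(1)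
    by (intro exI[of _ "min \<delta>1 \<delta>2"]) auto
  then show ?case unfolding g_def by (rule bigoI)
qed

text \<open>Only the terms of degree \<open>l\<close> to \<open>l + 3\<close> of the Taylor
  polynomial survive, and \<open>e ^ l\<close> is divided out. The case \<open>l = 0\<close> is the
  plain Taylor expansion; \<open>l = m\<close> and \<open>l = m - 1\<close> serve for
  \<open>f\<close> and its derivative at \<alpha>.\<close>

lemma cubic_expansion_taylor_quotient:
  fixes p :: "nat \<Rightarrow> 'a::real_normed_field \<Rightarrow> 'a"
  assumes S: "open S" "a \<in> S"
    and p: "\<And>k x. x \<in> S \<Longrightarrow> (p k has_field_derivative p (Suc k) x) (at x)"
    and z: "\<And>k. k < l \<Longrightarrow> p k a = 0"
  shows "cubic_expansion (at 0) (\<lambda>e. p 0 (a + e) / e ^ l) (p l a / fact l) (p (l + 1) a / fact (l + 1))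
           (p (l + 2) a / fact (l + 2)) (p (l + 3) a / fact (l + 3))"
proof -
  have sum: "(\<Sum>k<l + 4. p k a / fact k * e ^ k) =
      e ^ l * (p l a / fact l + p (l + 1) a / fact (l + 1) * e
        + p (l + 2) a / fact (l + 2) * e ^ 2 + p (l + 3) a / fact (l + 3) * e ^ 3)" (is "_ = e ^ l * ?q e") for e
  proof -
    have "(\<Sum>k<l. p k a / fact k * e ^ k) = 0" using z by simp
    moreover have "(\<Sum>k<l + 4. p k a / fact k * e ^ k) = (\<Sum>k<l. p k a / fact k * e ^ k)
      + p l a / fact l * e ^ l + p (l + 1) a / fact (l + 1) * e ^ (l + 1)
      + p (l + 2) a / fact (l + 2) * e ^ (l + 2) + p (l + 3) a / fact (l + 3) * e ^ (l + 3)"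
      by (simp add: numeral_eq_Suc del: fact_Suc power_Suc)
    ultimately show ?thesis by (simp add: power_add distrib_left power2_eq_square mult_ac del: fact_Suc)
  qed
  have nz: "\<forall>\<^sub>F e in at 0. e \<noteq> (0::'a)"
    by (simp add: eventually_at_filter)
  have "(\<lambda>e. p 0 (a + e) - e ^ l * ?q e) \<in> O[at 0](\<lambda>e. e ^ (l + 4))"
    using landau_o.big.filter_mono[OF _ taylor_bigo[OF S, of p "l + 4", OF p], of "at 0"]
    by (simp only: sum at_within_le_nhds)
  then have "(\<lambda>e. (p 0 (a + e) - e ^ l * ?q e) / e ^ l) \<in> O[at 0](\<lambda>e. e ^ (l + 4) / e ^ l)"
    by (intro landau_o.big.divide_right eventually_mono[OF nz]) auto
  also have "(\<lambda>e. (p 0 (a + e) - e ^ l * ?q e) / e ^ l) \<in> O[at 0](\<lambda>e. e ^ (l + 4) / e ^ l) \<longleftrightarrow>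
     (\<lambda>e. p 0 (a + e) / e ^ l - ?q e) \<in> O[at 0](\<lambda>e. e ^ 4)"
    by (intro landau_o.big.cong_ex eventually_mono[OF nz]) (auto simp: power_add diff_divide_distrib)
  finally show ?thesis unfolding cubic_expansion_def .
qed


section \<open>Expansions of smooth functions and of powers\<close>

lemma smooth_near_has_field_derivative:
  assumes "smooth_near f a"
  obtains S where "open S" "a \<in> S"
    "\<And>k x. x \<in> S \<Longrightarrow> ((deriv ^^ k) f has_field_derivative (deriv ^^ Suc k) f x) (at x)"
proof -
  obtain S where S: "open S" "a \<in> S"
    "\<And>n x. x \<in> S \<Longrightarrow> ((deriv ^^ n) f) field_differentiable (at x)"
    using assms unfolding smooth_near_def by blast
  have "((deriv ^^ k) f has_field_derivative (deriv ^^ Suc k) f x) (at x)" if "x \<in> S" for k x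
    using DERIV_deriv_iff_field_differentiable[of "(deriv ^^ k) f" x] S(3)[OF that] by simp
  with S(1,2) show ?thesis by (rule that)
qed

lemma smooth_near_cubic_expansion:
  assumes "smooth_near f 0"
  shows "cubic_expansion (nhds 0) f (f 0) (deriv f 0) ((deriv ^^ 2) f 0 / 2) ((deriv ^^ 3) f 0 / 6)"
proof -
  obtain S where S: "open S" "0 \<in> S"
    "\<And>k x. x \<in> S \<Longrightarrow> ((deriv ^^ k) f has_field_derivative (deriv ^^ Suc k) f x) (at x)"
    by (rule smooth_near_has_field_derivative[OF assms]) blast
  from cubic_expansion_taylor_quotient[OF S(1,2), of "\<lambda>k. (deriv ^^ k) f" 0, OF S(3)] show ?thesis
    by (intro cubic_expansion_nhds) (simp_all add: numeral_eq_Suc)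
qed

text \<open>This is the binomial series: \<open>p k\<close> is the \<open>k\<close>-th derivative of
  the power, with a falling factorial as coefficient. The two facts about \<open>powr\<close> are
  assumptions because they are proved separately for real and complex numbers.\<close>

lemma powr_cubic_expansion:
  fixes s :: "'a::{real_normed_field,ln}"
  assumes S: "open S" "(1::'a) \<in> S"
    and deriv: "\<And>s z. z \<in> S \<Longrightarrow> ((\<lambda>z::'a. z powr s) has_field_derivative s * z powr (s - 1)) (at z)"
    and one: "\<And>s. (1::'a) powr s = 1"
  shows "cubic_expansion (nhds 0) (\<lambda>t. (1 + t) powr s) 1 s (s * (s - 1) / 2) (s * (s - 1) * (s - 2) / 6)"
proof -
  define p where "p k x = (\<Prod>i<k. s - of_nat i) * x powr (s - of_nat k)" for k and x :: 'a
  have "(p k has_field_derivative p (Suc k) x) (at x)" if "x \<in> S" for k x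
    using DERIV_cmult[OF deriv[OF that, of "s - of_nat k"], of "\<Prod>i<k. s - of_nat i"]
    by (simp add: p_def[abs_def] mult_ac diff_diff_eq add.commute)
  from cubic_expansion_taylor_quotient[OF S, of p 0, OF this] show ?thesis
    by (intro cubic_expansion_nhds) (simp_all add: p_def one numeral_eq_Suc)
qed

section \<open>The error of one step\<close>

text \<open>
  The coefficients of \<open>W\<close> are those of \<open>r / (r + e r')\<close>. Of the second and third derivatives of
  the weights, only \<open>P''(0) = H''(0) + 2\<close> and \<open>P'''(0) = H'''(0) + 6 H''(0) - 24\<close> matter.
\<close>

lemma order_eight_error:
  fixes r W H P G :: "'a::real_normed_field \<Rightarrow> 'a"
  assumes r: "cubic_expansion (nhds 0) r 1 c1 c2 c3"
    and W: "cubic_expansion (at 0) W 1 (- c1) (2 * c1 ^ 2 - 2 * c2) (7 * c1 * c2 - 3 * c3 - 4 * c1 ^ 3)"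
    and H: "cubic_expansion (nhds 0) H 1 2 h2 h3"
    and P: "cubic_expansion (nhds 0) P 1 2 (h2 + 1) (2 * h2 - 4 + h3)"
    and G: "cubic_expansion (nhds 0) G 1 1 g2 g3"
  defines "y \<equiv> \<lambda>e. e * (1 - W e)"
  defines "u \<equiv> \<lambda>e. (1 - W e) * r (y e) / r e"
  defines "K \<equiv> \<lambda>e. 1 - r (y e) * H (u e) * (W e / r e)"
  defines "z \<equiv> \<lambda>e. y e * K e"
  defines "v \<equiv> \<lambda>e. K e * r (z e) / r (y e)"
  shows "(\<lambda>e. z e * (1 - r (z e) * (W e / r e) * (1 + 2 * u e * v e) * P (u e) * G (v e)))
           \<in> O[at 0](\<lambda>e. e ^ 8)"
    and "\<forall>\<^sub>F e in at 0. r e \<noteq> 0 \<and> r (y e) \<noteq> 0"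
proof -
  have F: "at 0 \<le> nhds (0::'a)" by (rule at_within_le_nhds)
  note mult = cubic_expansion_mult[OF F] and divide = cubic_expansion_divide[OF F] and compose = cubic_expansion_compose[OF F]
  note const = cubic_expansion_const[of "at (0::'a)"]
  have r': "cubic_expansion (at 0) r 1 c1 c2 c3" by (rule cubic_expansion_mono[OF r F])
  have q: "cubic_expansion (at 0) (\<lambda>e. 1 - W e) 0 c1 (2 * c2 - 2 * c1 ^ 2) (3 * c3 - 7 * c1 * c2 + 4 * c1 ^ 3)"
    using cubic_expansion_diff[OF const[of 1] W] by (simp add: algebra_simps)
  have y: "cubic_expansion (at 0) y 0 0 c1 (2 * c2 - 2 * c1 ^ 2)"
    using mult[OF cubic_expansion_ident q] by (simp add: y_def)
  have ry: "cubic_expansion (at 0) (\<lambda>e. r (y e)) 1 0 (c1 ^ 2) (2 * c1 * c2 - 2 * c1 ^ 3)"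
    using compose[OF r y] by (simp add: algebra_simps power2_eq_square power3_eq_cube)
  have u: "cubic_expansion (at 0) u 0 c1 (2 * c2 - 3 * c1 ^ 2) (3 * c3 - 10 * c1 * c2 + 8 * c1 ^ 3)"
    unfolding u_def by (rule divide[OF mult[OF q ry] r']) (simp, algebra+)
  have Wr: "cubic_expansion (at 0) (\<lambda>e. W e / r e) 1 (- 2 * c1) (4 * c1 ^ 2 - 3 * c2)
      (12 * c1 * c2 - 4 * c3 - 8 * c1 ^ 3)"
    by (rule divide[OF W r']) (simp, algebra+)
  have Hu: "cubic_expansion (at 0) (\<lambda>e. H (u e)) 1 (2 * c1) (4 * c2 + (h2 - 6) * c1 ^ 2)
      (6 * c3 + (4 * h2 - 20) * c1 * c2 + (16 + h3 - 6 * h2) * c1 ^ 3)"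
    using compose[OF H u] by (simp add: algebra_simps power2_eq_square power3_eq_cube)
  have Pu: "cubic_expansion (at 0) (\<lambda>e. P (u e)) 1 (2 * c1) (4 * c2 + (h2 - 5) * c1 ^ 2)
      (6 * c3 + (4 * h2 - 16) * c1 * c2 + (6 + h3 - 4 * h2) * c1 ^ 3)"
    using compose[OF P u] by (simp add: algebra_simps power2_eq_square power3_eq_cube)
  \<comment> \<open>These are the leading coefficients of \<open>K\<close>; the constant and linear
    terms cancel by H(0) = 1 and H'(0) = 2. Since \<open>r (z e)\<close> and \<open>r (y e)\<close>
    differ from 1 by O(e^2), \<open>v\<close> has the same coefficients.\<close>
  define k2 where "k2 = (5 - h2) * c1 ^ 2 - c2"
  define k3 where "k3 = (20 - 4 * h2) * c1 * c2 - 2 * c3 + (8 * h2 - 26 - h3) * c1 ^ 3"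
  have K: "cubic_expansion (at 0) K 0 0 k2 k3"
    using cubic_expansion_diff[OF const[of 1] mult[OF mult[OF ry Hu] Wr]]
    by (simp add: K_def k2_def k3_def algebra_simps power2_eq_square power3_eq_cube)
  have z: "cubic_expansion (at 0) z 0 0 0 0"
    using mult[OF y K] by (simp add: z_def)
  have rz: "cubic_expansion (at 0) (\<lambda>e. r (z e)) 1 0 0 0"
    using compose[OF r z] by simp
  have v: "cubic_expansion (at 0) v 0 0 k2 k3"
    unfolding v_def by (rule divide[OF mult[OF K rz] ry]) simp_all
  have Gv: "cubic_expansion (at 0) (\<lambda>e. G (v e)) 1 0 k2 k3"
    using compose[OF G v] by simp
  have uv: "cubic_expansion (at 0) (\<lambda>e. 1 + 2 * u e * v e) 1 0 0 (2 * c1 * k2)"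
    using cubic_expansion_add[OF const[of 1] mult[OF mult[OF const[of 2] u] v]] by (simp add: algebra_simps)
  \<comment> \<open>The product of \<open>W e / r e\<close> and \<open>P (u e)\<close> has linear
    coefficient 0, quadratic coefficient \<open>- k2\<close> and cubic coefficient
    \<open>- k3 - 2 * c1 * k2\<close>. The factor \<open>G (v e)\<close> cancels \<open>k2\<close>
    and \<open>k3\<close>, and the factor \<open>1 + 2 * u e * v e\<close> cancels the rest.\<close>
  have "cubic_expansion (at 0) (\<lambda>e. 1 - r (z e) * (W e / r e) * (1 + 2 * u e * v e) * P (u e) * G (v e)) 0 0 0 0"
    using cubic_expansion_diff[OF const[of 1] mult[OF mult[OF mult[OF mult[OF rz Wr] uv] Pu] Gv]]
    by (simp add: k2_def k3_def algebra_simps power2_eq_square power3_eq_cube)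
  with z have "(\<lambda>e. z e * (1 - r (z e) * (W e / r e) * (1 + 2 * u e * v e) * P (u e) * G (v e)))
      \<in> O[at 0](\<lambda>e. e ^ 4 * e ^ 4)"
    unfolding cubic_expansion_0_iff by (rule landau_o.big.mult)
  then show "(\<lambda>e. z e * (1 - r (z e) * (W e / r e) * (1 + 2 * u e * v e) * P (u e) * G (v e)))
           \<in> O[at 0](\<lambda>e. e ^ 8)"
    by (simp flip: power_add)
  show "\<forall>\<^sub>F e in at 0. r e \<noteq> 0 \<and> r (y e) \<noteq> 0"
    using tendsto_imp_eventually_ne[OF cubic_expansion_tendsto[OF r' F], of 0]
      tendsto_imp_eventually_ne[OF cubic_expansion_tendsto[OF ry F], of 0]
    by (simp add: eventually_conj)
qed

section \<open>Expansions of the root of the cofactor and of the Newton quotient\<close>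

text \<open>Both expansions come from the Taylor coefficients of \<open>f\<close>: the root by the
  binomial series, the Newton quotient by dividing the series of \<open>f\<close> by that of its
  derivative. The root itself is never differentiated; the relation between the two sets of
  coefficients is checked algebraically.\<close>

lemma cofactor_root_newton_quotient_expansions:
  fixes f :: "'a::{real_normed_field,ln} \<Rightarrow> 'a"
  assumes m: "m \<ge> 1" and f: "smooth_near f \<alpha>" "zero_of_multiplicity f \<alpha> m"
    and powr: "\<And>s::'a. cubic_expansion (nhds 0) (\<lambda>t. (1 + t) powr s) 1 s (s * (s - 1) / 2) (s * (s - 1) * (s - 2) / 6)"
    and one: "\<And>s. (1::'a) powr s = 1"
  obtains c1 c2 c3 where
    "cubic_expansion (nhds 0) (\<lambda>e. cofactor_root f \<alpha> m (\<alpha> + e)) 1 c1 c2 c3"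
    "cubic_expansion (at 0) (\<lambda>e. of_nat m * f (\<alpha> + e) / (e * deriv f (\<alpha> + e)))
       1 (- c1) (2 * c1 ^ 2 - 2 * c2) (7 * c1 * c2 - 3 * c3 - 4 * c1 ^ 3)"
proof -
  have F: "at 0 \<le> nhds (0::'a)" by (rule at_within_le_nhds)
  obtain S where S: "open S" "\<alpha> \<in> S"
    "\<And>k x. x \<in> S \<Longrightarrow> ((deriv ^^ k) f has_field_derivative (deriv ^^ Suc k) f x) (at x)"
    by (rule smooth_near_has_field_derivative[OF f(1)]) blast
  obtain l where l: "m = Suc l" using m by (cases m) auto
  define a where "a = (deriv ^^ m) f \<alpha> / fact m"
  \<comment> \<open>These are the Taylor coefficients of the cofactor, normalised so that
    \<open>h 0 = 1\<close>.\<close>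
  define h where "h j = (deriv ^^ (m + j)) f \<alpha> / fact (m + j) / a" for j
  define \<mu> :: 'a where "\<mu> = of_nat m"
  define s where "s = 1 / \<mu>"
  have \<mu>: "\<mu> \<noteq> 0" using m by (auto simp: \<mu>_def)
  have a: "a \<noteq> 0" using f(2) by (simp add: a_def zero_of_multiplicity_def)
  have zero: "(deriv ^^ k) f \<alpha> = 0" if "k < m" for k
    using f(2) that by (simp add: zero_of_multiplicity_def)
  have h0: "h 0 = 1" using a by (simp add: h_def a_def)
  have co_eq: "cofactor f \<alpha> m (\<alpha> + e) = f (\<alpha> + e) / (a * e ^ m)" if "e \<noteq> 0" for e
    using that by (simp add: cofactor_def a_def)
  have em: "e ^ m = e * e ^ l" for e :: 'a
    by (simp add: l)
  have "cubic_expansion (at 0) (\<lambda>e. f (\<alpha> + e) / e ^ m) (a * h 0) (a * h 1) (a * h 2) (a * h 3)"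
    using cubic_expansion_taylor_quotient[OF S(1,2), of "\<lambda>k. (deriv ^^ k) f" m, OF S(3)] zero a by (simp add: h_def del: fact_Suc)
  from cubic_expansion_mult[OF F cubic_expansion_const[of _ "1 / a"] this]
  have "cubic_expansion (at 0) (\<lambda>e. 1 / a * (f (\<alpha> + e) / e ^ m)) 1 (h 1) (h 2) (h 3)"
    using a h0 by simp
  then have co: "cubic_expansion (at 0) (\<lambda>e. cofactor f \<alpha> m (\<alpha> + e)) 1 (h 1) (h 2) (h 3)"
    by (rule cubic_expansion_cong) (simp add: co_eq)
  \<comment> \<open>Differentiation multiplies the coefficient of degree \<open>m + j\<close> by
    \<open>m + j\<close>, and \<open>m = Suc l\<close> turns the factorial of \<open>m + j\<close>
    into that of \<open>l + j\<close>.\<close>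
  have fact: "(deriv ^^ (m + j)) f \<alpha> / fact (l + j) = a * ((\<mu> + of_nat j) * h j)" for j
    using a by (simp add: h_def l \<mu>_def divide_simps del: of_nat_Suc) (simp add: field_simps)
  have zero': "deriv ((deriv ^^ k) f) \<alpha> = 0" if "k < l" for k
    using zero[of "Suc k"] that by (simp add: l)
  have "cubic_expansion (at 0) (\<lambda>e. deriv f (\<alpha> + e) / e ^ l) (a * ((\<mu> + of_nat 0) * h 0)) (a * ((\<mu> + of_nat 1) * h 1))
      (a * ((\<mu> + of_nat 2) * h 2)) (a * ((\<mu> + of_nat 3) * h 3))"
    unfolding fact[symmetric]
    using cubic_expansion_taylor_quotient[OF S(1,2), of "\<lambda>k. (deriv ^^ Suc k) f" l, OF S(3)] zero'
    by (simp add: l del: fact_Suc)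
  from cubic_expansion_mult[OF F cubic_expansion_const[of _ "1 / a"] this]
  have T: "cubic_expansion (at 0) (\<lambda>e. 1 / a * (deriv f (\<alpha> + e) / e ^ l)) \<mu> ((\<mu> + 1) * h 1) ((\<mu> + 2) * h 2) ((\<mu> + 3) * h 3)"
    using a h0 by simp
  define c1 where "c1 = s * h 1"
  define c2 where "c2 = s * h 2 + s * (s - 1) / 2 * h 1 ^ 2"
  define c3 where "c3 = s * h 3 + 2 * (s * (s - 1) / 2) * h 1 * h 2 + s * (s - 1) * (s - 2) / 6 * h 1 ^ 3"
  have "cubic_expansion (at 0) (\<lambda>e. cofactor f \<alpha> m (\<alpha> + e) - 1) 0 (h 1) (h 2) (h 3)"
    using cubic_expansion_diff[OF co cubic_expansion_const[of _ 1]] by simp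
  from cubic_expansion_compose[OF F powr[of s] this]
  have "cubic_expansion (at 0) (\<lambda>e. cofactor_root f \<alpha> m (\<alpha> + e)) 1 c1 c2 c3"
    by (simp add: cofactor_root_def c1_def c2_def c3_def s_def \<mu>_def algebra_simps)
  \<comment> \<open>The cofactor is set to 1 at \<alpha>, which agrees with the constant
    term.\<close>
  then have r: "cubic_expansion (nhds 0) (\<lambda>e. cofactor_root f \<alpha> m (\<alpha> + e)) 1 c1 c2 c3"
    by (rule cubic_expansion_nhds) (simp add: cofactor_root_def cofactor_def one)
  have "cubic_expansion (at 0) (\<lambda>e. \<mu> * cofactor f \<alpha> m (\<alpha> + e)) \<mu> (\<mu> * h 1) (\<mu> * h 2) (\<mu> * h 3)"
    using cubic_expansion_mult[OF F cubic_expansion_const[of _ \<mu>] co] by simp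
  from cubic_expansion_divide[OF F this T \<mu>]
  have "cubic_expansion (at 0) (\<lambda>e. \<mu> * cofactor f \<alpha> m (\<alpha> + e) / (1 / a * (deriv f (\<alpha> + e) / e ^ l)))
      1 (- c1) (2 * c1 ^ 2 - 2 * c2) (7 * c1 * c2 - 3 * c3 - 4 * c1 ^ 3)"
    using \<mu> by (auto simp: c1_def c2_def c3_def s_def field_simps power2_eq_square power3_eq_cube)
  then have "cubic_expansion (at 0) (\<lambda>e. of_nat m * f (\<alpha> + e) / (e * deriv f (\<alpha> + e)))
       1 (- c1) (2 * c1 ^ 2 - 2 * c2) (7 * c1 * c2 - 3 * c3 - 4 * c1 ^ 3)"
    by (rule cubic_expansion_cong) (use a in \<open>simp add: co_eq em \<mu>_def\<close>)
  with r show ?thesis by (rule that)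
qed

section \<open>From the expansions to the iteration\<close>

text \<open>The properties of \<open>powr\<close> are assumptions, so that one proof covers both
  fields. It identifies the steps of the method with the error functions of
  \<open>order_eight_error\<close>.\<close>

lemma order_eight:
  fixes f :: "'a::{real_normed_field,ln} \<Rightarrow> 'a"
  assumes m: "m \<ge> 1" and f: "smooth_near f \<alpha>" "zero_of_multiplicity f \<alpha> m"
    and powr: "\<And>s::'a. cubic_expansion (nhds 0) (\<lambda>t. (1 + t) powr s) 1 s (s * (s - 1) / 2) (s * (s - 1) * (s - 2) / 6)"
    and one: "\<And>s. (1::'a) powr s = 1"
    and smooth: "smooth_near H 0" "smooth_near P 0" "smooth_near G 0"
    and weights: "weight_conditions m H P G"
  shows "has_order 8 f \<alpha> m H P G"
proof -
  define r where "r e = cofactor_root f \<alpha> m (\<alpha> + e)" for e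
  define W where "W e = of_nat m * f (\<alpha> + e) / (e * deriv f (\<alpha> + e))" for e
  define y where "y e = e * (1 - W e)" for e
  define u where "u e = (1 - W e) * r (y e) / r e" for e
  define K where "K e = 1 - r (y e) * H (u e) * (W e / r e)" for e
  define z where "z e = y e * K e" for e
  define v where "v e = K e * r (z e) / r (y e)" for e
  define E where "E e = z e * (1 - r (z e) * (W e / r e) * (1 + 2 * u e * v e) * P (u e) * G (v e))" for e
  define h2 where "h2 = (deriv ^^ 2) H 0 / 2"
  define h3 where "h3 = (deriv ^^ 3) H 0 / 6"
  obtain c1 c2 c3 where r: "cubic_expansion (nhds 0) r 1 c1 c2 c3"
    and W: "cubic_expansion (at 0) W 1 (- c1) (2 * c1 ^ 2 - 2 * c2) (7 * c1 * c2 - 3 * c3 - 4 * c1 ^ 3)"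
    unfolding r_def[abs_def] W_def[abs_def]
    by (rule cofactor_root_newton_quotient_expansions[OF m f powr one]) blast
  have H: "cubic_expansion (nhds 0) H 1 2 h2 h3"
    using smooth_near_cubic_expansion[OF smooth(1)] weights by (simp add: weight_conditions_def h2_def h3_def)
  \<comment> \<open>The multiplicity is eliminated through m = H''(0) - 9.\<close>
  have P2: "(deriv ^^ 2) P 0 / 2 = h2 + 1" and P3: "(deriv ^^ 3) P 0 / 6 = 2 * h2 - 4 + h3"
    using weights by (simp_all add: weight_conditions_def h2_def h3_def field_simps)
  have P: "cubic_expansion (nhds 0) P 1 2 (h2 + 1) (2 * h2 - 4 + h3)"
    using smooth_near_cubic_expansion[OF smooth(2), unfolded P2 P3] weights by (simp add: weight_conditions_def)
  have G: "cubic_expansion (nhds 0) G 1 1 ((deriv ^^ 2) G 0 / 2) ((deriv ^^ 3) G 0 / 6)"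
    using smooth_near_cubic_expansion[OF smooth(3)] weights by (simp add: weight_conditions_def)
  have "E \<in> O[at 0](\<lambda>e. e ^ 8)" and ev: "\<forall>\<^sub>F e in at 0. r e \<noteq> 0 \<and> r (y e) \<noteq> 0"
    using order_eight_error[OF r W H P G]
    by (simp_all add: E_def[abs_def] v_def z_def K_def u_def y_def)
  then obtain C where "\<forall>\<^sub>F e in at 0. norm (E e) \<le> C * norm (e ^ 8)"
    by (elim landau_o.bigE)
  with ev have "\<forall>\<^sub>F e in at 0. r e \<noteq> 0 \<and> r (y e) \<noteq> 0 \<and> norm (E e) \<le> C * norm (e ^ 8)"
    by eventually_elim simp
  then obtain d where d: "d > 0"
    "\<And>e. e \<noteq> 0 \<Longrightarrow> norm e < d \<Longrightarrow> r e \<noteq> 0 \<and> r (y e) \<noteq> 0 \<and> norm (E e) \<le> C * norm (e ^ 8)"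
    by (auto simp: eventually_at)
  have f\<alpha>: "f \<alpha> = 0"
    using f(2) m by (auto simp: zero_of_multiplicity_def dest: spec[of _ 0])
  have "norm (next_iterate f \<alpha> m H P G x - \<alpha>) \<le> C * norm (x - \<alpha>) ^ 8"
    if x: "x \<in> ball \<alpha> d" "step_defined f m x" for x
  proof -
    define e where "e = x - \<alpha>"
    have xe: "x = \<alpha> + e" by (simp add: e_def)
    \<comment> \<open>A defined step excludes \<open>e = 0\<close> and, further below,
      \<open>y e = 0\<close>. Thus a bound along \<open>at 0\<close> suffices, and \<open>e\<close>
      and \<open>y e\<close> may be cancelled in the two ratios.\<close>
    have e: "e \<noteq> 0" using x(2) f\<alpha> by (auto simp: step_defined_def xe)
    have "norm e < d" using x(1) by (simp add: e_def dist_norm norm_minus_commute)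
    note d = d(2)[OF e this]
    \<comment> \<open>If the derivative of \<open>f\<close> vanishes at \<open>x\<close>, both sides
      are 0, as division by 0 yields 0.\<close>
    have w: "of_nat m * (f x / deriv f x) = e * W e"
      using e by (simp add: W_def xe)
    have ys: "y_step f m x = \<alpha> + y e"
      unfolding y_step_def w by (simp add: y_def xe algebra_simps)
    have "y e \<noteq> 0" using x(2) f\<alpha> by (auto simp: step_defined_def ys)
    have us: "u_ratio f \<alpha> m x = u e"
      unfolding u_ratio_def ratio_root_def ys using e by (simp add: u_def r_def xe y_def)
    have "z_step f \<alpha> m H x = \<alpha> + y e - u e * H (u e) * (of_nat m * (f x / deriv f x))"
      by (simp add: z_step_def us ys Let_def mult_ac)
    also have "\<dots> = \<alpha> + z e"
      unfolding w z_def K_def using d by (simp add: u_def y_def field_simps)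
    finally have zs: "z_step f \<alpha> m H x = \<alpha> + z e" .
    have vs: "v_ratio f \<alpha> m H x = v e"
      using \<open>y e \<noteq> 0\<close> by (simp add: v_ratio_def zs ys ratio_root_def v_def r_def z_def)
    have "next_iterate f \<alpha> m H P G x = \<alpha> + z e
        - u e * v e * (1 + 2 * u e * v e) * P (u e) * G (v e) * (of_nat m * (f x / deriv f x))"
      by (simp add: next_iterate_def us vs zs Let_def mult_ac)
    \<comment> \<open>In the product the factors \<open>r (y e)\<close> and \<open>K e\<close>
      telescope: this is \<open>u v F(e) = F(z)\<close> multiplied by
      \<open>W e / r e\<close>.\<close>
    moreover have "u e * v e * (e * W e) = z e * r (z e) * (W e / r e)"
      using d by (simp add: u_def v_def z_def y_def)
    ultimately have "next_iterate f \<alpha> m H P G x - \<alpha> = E e"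
      unfolding w E_def by algebra
    then show ?thesis using d by (simp add: e_def norm_power)
  qed
  then show ?thesis
    unfolding has_order_def using d(1)
    by (intro exI[of _ "ball \<alpha> d"] exI[of _ C]) auto
qed

section \<open>The real and the complex case\<close>

lemma analytic_smooth_near:
  assumes "f analytic_on {a}"
  shows "smooth_near f a"
proof -
  obtain S where S: "open S" "a \<in> S" "f holomorphic_on S"
    using assms by (auto simp: analytic_at)
  then have "((deriv ^^ n) f) field_differentiable (at x)" if "x \<in> S" for n x
    using that holomorphic_higher_deriv[of f S n] by (auto simp: holomorphic_on_open field_differentiable_def)
  with S show ?thesis unfolding smooth_near_def by blast
qed

theorem mainTheorem2:
  fixes m :: nat
  assumes "m \<ge> 1"
  shows
    "(\<forall>(f :: real \<Rightarrow> real) (\<alpha> :: real) (H :: real \<Rightarrow> real) (P :: real \<Rightarrow> real) (G :: real \<Rightarrow> real).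
        smooth_near f \<alpha> \<longrightarrow> zero_of_multiplicity f \<alpha> m \<longrightarrow>
        smooth_near H 0 \<longrightarrow> smooth_near P 0 \<longrightarrow> smooth_near G 0 \<longrightarrow>
        weight_conditions m H P G \<longrightarrow>
        has_order 8 f \<alpha> m H P G) \<and>
     (\<forall>(f :: complex \<Rightarrow> complex) (\<alpha> :: complex) (H :: complex \<Rightarrow> complex)
        (P :: complex \<Rightarrow> complex) (G :: complex \<Rightarrow> complex).
        f analytic_on {\<alpha>} \<longrightarrow> zero_of_multiplicity f \<alpha> m \<longrightarrow>
        H analytic_on {0} \<longrightarrow> P analytic_on {0} \<longrightarrow> G analytic_on {0} \<longrightarrow>
        weight_conditions m H P G \<longrightarrow>
        has_order 8 f \<alpha> m H P G)"
proof -
  have real: "cubic_expansion (nhds 0) (\<lambda>t. (1 + t) powr s) 1 s (s * (s - 1) / 2) (s * (s - 1) * (s - 2) / 6)"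
    for s :: real
    by (rule powr_cubic_expansion[of "{0<..}"]) (auto intro: has_real_derivative_powr)
  have complex: "cubic_expansion (nhds 0) (\<lambda>t. (1 + t) powr s) 1 s (s * (s - 1) / 2) (s * (s - 1) * (s - 2) / 6)"
    for s :: complex
    \<comment> \<open>The slit plane is the open set around 1 on which the principal power is
      differentiable by the usual rule; for real numbers it is the positive half-line.\<close>
    by (rule powr_cubic_expansion[of "- \<real>\<^sub>\<le>\<^sub>0"]) (auto intro: has_field_derivative_powr simp flip: closed_def)
  show ?thesis
    using assms by (auto intro!: order_eight real complex intro: analytic_smooth_near)
qed

end
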